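(* Let $n=\prod_{i=1}^k p_i^{\alpha_i}$ be the prime factorization of an integer $n>1$ with $\alpha_i>0$ for all $i$, and let $a\in GP(\mathbb Z_n)\setminus P(\mathbb Z_n)$. Then $a_l=b^{\varphi(n/b)}$ (computed in $\mathbb Z_n$), where $b=\prod_{j:\ a\not\equiv 1 \pmod{p_j^{\alpha_j}}} p_j^{\alpha_j}$ and $\varphi$ is Euler's totient function.
   Context: On $\mathbb Z_n$ define the partial order $\leq$ by: $a\leq b$ iff $a=b$ or $a\equiv ab\pmod n$; write $a<b$ for $a\leq b$, $a\neq b$. $GP(\mathbb Z_n)$ is the set of $a\in\mathbb Z_n$ with $a^m=a$ for some integer $m\geq2$, and $P(\mathbb Z_n)=\{a: a^2=a\}$. For $a\in GP(\mathbb Z_n)\setminus P(\mathbb Z_n)$, the lower covering projection $a_l$ is the unique element of $GP(\mathbb Z_n)$ that is a lower cover of $a$ in the poset $(GP(\mathbb Z_n),\leq)$; it is known to exist, to be a projection, and to satisfy: for $x\in GP(\mathbb Z_n)$, $x<a$ iff $x\leq a_l$ (i.e. $a_l$ is the greatest element of $\{x\in GP(\mathbb Z_n): x<a\}$). *)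

theory Defs
  imports "HOL-Number_Theory.Number_Theory"
begin

abbreviation Zn :: "nat \<Rightarrow> int ring" where
  "Zn n \<equiv> residue_ring (int n)"

definition Zn_le :: "nat \<Rightarrow> int \<Rightarrow> int \<Rightarrow> bool" where
  "Zn_le n a b \<longleftrightarrow> a = b \<or> [a = a * b] (mod int n)"

definition Zn_less :: "nat \<Rightarrow> int \<Rightarrow> int \<Rightarrow> bool" where
  "Zn_less n a b \<longleftrightarrow> Zn_le n a b \<and> a \<noteq> b"

definition GP :: "nat \<Rightarrow> int set" where
  "GP n = {a \<in> carrier (Zn n). \<exists>m::nat. m \<ge> 2 \<and> a [^]\<^bsub>Zn n\<^esub> m = a}"

definition Proj :: "nat \<Rightarrow> int set" where
  "Proj n = {a \<in> carrier (Zn n). a [^]\<^bsub>Zn n\<^esub> (2::nat) = a}"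

definition is_lower_cover :: "nat \<Rightarrow> int \<Rightarrow> int \<Rightarrow> bool" where
  "is_lower_cover n x a \<longleftrightarrow>
     x \<in> GP n \<and> a \<in> GP n \<and> Zn_less n x a \<and>
     \<not> (\<exists>y \<in> GP n. Zn_less n x y \<and> Zn_less n y a)"

(* Only meaningful for a in GP n - Proj n, where the lower cover exists and is unique. *)
definition lower_covering_projection :: "nat \<Rightarrow> int \<Rightarrow> int" where
  "lower_covering_projection n a = (THE x. is_lower_cover n x a)"

end

theory Submission
  imports Defs
begin

text \<open>
  Modulo each \<open>p\<^sub>j ^ \<alpha>\<^sub>j\<close>, an element of \<open>GP n\<close> is either zero or a unit. Hence a generalized
  projection \<open>x\<close> with \<open>x = x * a\<close> must vanish at every component where \<open>a \<noteq> 1\<close>, that is, it is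
  divisible by \<open>b\<close>; conversely, \<open>b\<close> divides \<open>x\<close> implies \<open>x = x * a\<close>, as \<open>n div b\<close> divides
  \<open>a - 1\<close>. By Euler's theorem \<open>b ^ totient (n div b)\<close> is the idempotent that is \<open>0\<close> modulo \<open>b\<close>
  and \<open>1\<close> modulo the coprime cofactor \<open>n div b\<close>, so it is the greatest such \<open>x\<close>.
\<close>

lemma residue_ring_pow:
  assumes "n > 1" and "a \<in> carrier (Zn n)"
  shows "a [^]\<^bsub>Zn n\<^esub> (m::nat) = a ^ m mod int n"
proof -
  interpret residues "int n" "Zn n"
    using assms(1) by unfold_locales auto
  have "a mod int n = a"
    using assms(2) by (simp add: res_carrier_eq)
  then show ?thesis
    using pow_cong[of a m] by simp
qed

lemma carrier_Zn: "carrier (Zn n) = {0..int n - 1}"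
  by (simp add: residue_ring_def)

lemma eq_if_cong_Zn:
  assumes "a \<in> carrier (Zn n)" "b \<in> carrier (Zn n)" "[a = b] (mod int n)"
  shows "a = b"
  using assms by (auto simp: carrier_Zn intro!: cong_less_imp_eq_int[of _ "int n"])

text \<open>In \<open>x ^ m - x = x * (x ^ (m - 1) - 1)\<close> the second factor is -1 modulo
  \<open>p\<close>, hence coprime to \<open>p ^ r\<close>, so the whole prime power must divide
  \<open>x\<close>.\<close>

lemma prime_power_dvd_if_pow_cong_self:
  fixes x :: int
  assumes "prime p" and "m \<ge> 2" and "[x ^ m = x] (mod p ^ r)" and "p dvd x"
  shows "p ^ r dvd x"
proof -
  obtain l where l: "m = Suc (Suc l)"
    using assms(2) by (metis One_nat_def Suc_1 Suc_le_D Suc_le_mono)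
  have "x ^ m - x = x * (x ^ Suc l - 1)"
    by (simp add: l algebra_simps)
  then have dvd: "p ^ r dvd x * (x ^ Suc l - 1)"
    using assms(3) by (simp add: cong_iff_dvd_diff)
  have "\<not> p dvd x ^ Suc l - 1"
  proof
    assume "p dvd x ^ Suc l - 1"
    moreover have "p dvd x ^ Suc l"
      using assms(4) by simp
    ultimately have "p dvd x ^ Suc l - (x ^ Suc l - 1)"
      by (rule dvd_diff[rotated])
    then show False
      using assms(1) by (simp add: not_prime_unit)
  qed
  then have "coprime (p ^ r) (x ^ Suc l - 1)"
    using assms(1) by (simp add: prime_imp_coprime del: power_Suc)
  then show ?thesis
    using dvd by (simp add: coprime_dvd_mult_left_iff)
qed

text \<open>If \<open>p\<close> did not divide \<open>x\<close>, then cancelling \<open>x\<close>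
  from \<open>x * a = x\<close> would force \<open>a = 1\<close>. So \<open>p dvd x\<close>, and the
  previous lemma applies.\<close>

lemma prime_power_dvd_if_mult_fixed:
  fixes x a :: int
  assumes "prime p" and "m \<ge> 2" and "[x ^ m = x] (mod p ^ r)"
    and "[x = x * a] (mod p ^ r)" and "\<not> [a = 1] (mod p ^ r)"
  shows "p ^ r dvd x"
proof (cases "p dvd x")
  case True
  then show ?thesis
    using assms(1-3) by (rule prime_power_dvd_if_pow_cong_self[rotated 3])
next
  case False
  then have "coprime x (p ^ r)"
    using assms(1) by (simp add: prime_imp_coprime coprime_commute)
  moreover have "[x * a = x * 1] (mod p ^ r)"
    using assms(4) by (simp add: cong_sym)
  ultimately have "[a = 1] (mod p ^ r)"
    using cong_mult_lcancel by blast
  then show ?thesis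
    using assms(5) by simp
qed

lemma prod_dvd_if_pairwise_coprime:
  fixes f :: "'a \<Rightarrow> int"
  assumes "\<And>i. i \<in> A \<Longrightarrow> f i dvd x"
    and "\<And>i j. i \<in> A \<Longrightarrow> j \<in> A \<Longrightarrow> i \<noteq> j \<Longrightarrow> coprime (f i) (f j)"
  shows "prod f A dvd x"
  using assms
proof (induction A rule: infinite_finite_induct)
  case (insert i A)
  then have "coprime (f i) (prod f A)"
    by (intro prod_coprime_right) auto
  with insert show ?case
    by (simp add: divides_mult)
qed simp_all

text \<open>Any lower cover \<open>x\<close> other than \<open>e\<close> would satisfy
  \<open>x < e < a\<close>, so the greatest element strictly below \<open>a\<close> is its only
  lower cover.\<close>

lemma lower_covering_projection_eqI:
  assumes e: "e \<in> GP n" "Zn_less n e a" and "a \<in> GP n"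
    and greatest: "\<And>x. x \<in> GP n \<Longrightarrow> Zn_less n x a \<Longrightarrow> Zn_le n x e"
  shows "lower_covering_projection n a = e"
  unfolding lower_covering_projection_def
proof (rule the_equality)
  have False if y: "y \<in> GP n" "Zn_less n e y" "Zn_less n y a" for y
  proof -
    \<comment> \<open>Antisymmetry: \<open>y = y * e = e * y = e\<close> by commutativity.\<close>
    have "[y = y * e] (mod int n)" "[e = e * y] (mod int n)" "e \<noteq> y"
      using greatest[OF y(1,3)] y(2) by (auto simp: Zn_le_def Zn_less_def)
    moreover from this have "[y = e] (mod int n)"
      by (metis cong_sym cong_trans mult.commute)
    ultimately show False
      using e(1) y(1) eq_if_cong_Zn[of y n e] by (auto simp: GP_def)
  qed
  then show "is_lower_cover n e a"
    using e assms(3) by (auto simp: is_lower_cover_def)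
  fix x assume "is_lower_cover n x a"
  then show "x = e"
    using e greatest[of x] by (auto simp: is_lower_cover_def Zn_less_def)
qed

text \<open>Isolates the order theory: the prime factorization of \<open>n\<close> enters only
  through \<open>below\<close>.\<close>

lemma lower_covering_projection_eq_idempotent:
  assumes "n > 1" and n: "n = b * c" and a: "a \<in> GP n - Proj n"
    and a_cong: "[a = 1] (mod int c)"
    and below: "\<And>x. x \<in> GP n \<Longrightarrow> [x = x * a] (mod int n) \<Longrightarrow> int b dvd x"
    and e: "e \<in> carrier (Zn n)" "int b dvd e" "[e = 1] (mod int c)"
  shows "lower_covering_projection n a = e"
proof -
  \<comment> \<open>Used with \<open>y = e\<close> for the idempotence and the maximality of
    \<open>e\<close>, and with \<open>y = a\<close> for \<open>e \<le> a\<close>.\<close>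
  have fixed: "[x = x * y] (mod int n)" if "int b dvd x" "[y = 1] (mod int c)" for x y
  proof -
    have "int b * int c dvd x * (y - 1)"
      using that by (intro mult_dvd_mono) (simp_all add: cong_iff_dvd_diff)
    then have "int n dvd x * y - x"
      by (simp add: n algebra_simps)
    then show ?thesis
      by (simp add: cong_iff_dvd_diff dvd_diff_commute)
  qed
  have "e ^ 2 mod int n = e"
    using fixed[OF e(2,3)] e(1)
    by (auto simp: power2_eq_square cong_def carrier_Zn)
  then have proj: "e \<in> Proj n"
    using assms(1) e(1) by (simp add: Proj_def residue_ring_pow)
  show ?thesis
  proof (rule lower_covering_projection_eqI)
    show "e \<in> GP n"
      using proj by (auto simp: GP_def Proj_def)
    \<comment> \<open>Strictness holds because \<open>e\<close> is a projection and \<open>a\<close>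
      is not.\<close>
    show "Zn_less n e a"
      using proj a fixed[OF e(2) a_cong] by (auto simp: Zn_less_def Zn_le_def)
    show "a \<in> GP n"
      using a by simp
    show "Zn_le n x e" if "x \<in> GP n" "Zn_less n x a" for x
      using below[OF that(1)] that(2) fixed[OF _ e(3), of x] by (auto simp: Zn_less_def Zn_le_def)
  qed
qed

text \<open>Reducing \<open>b\<close> modulo \<open>n\<close> matters when \<open>b = n\<close>,
  which lies outside the carrier; then \<open>c = 1\<close> and \<open>e = 0\<close>.\<close>

lemma idempotent_by_Euler:
  assumes "n > 1" and n: "n = b * c" and "coprime b c"
  defines "e \<equiv> (int b mod int n) [^]\<^bsub>Zn n\<^esub> totient c"
  shows "e \<in> carrier (Zn n)" "int b dvd e" "[e = 1] (mod int c)"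
proof -
  have "int b mod int n \<in> carrier (Zn n)"
    using assms(1) by (simp add: carrier_Zn)
  then have e: "e = int b ^ totient c mod int n"
    using assms(1) by (simp add: e_def residue_ring_pow power_mod)
  show "e \<in> carrier (Zn n)"
    using assms(1) by (simp add: e carrier_Zn)
  \<comment> \<open>This makes the exponent \<open>totient c\<close> positive; a zeroth power would
    lose the factor \<open>b\<close>.\<close>
  have "c > 0"
    using assms(1) n by (cases c) auto
  then have "int b dvd int b ^ totient c"
    by (simp add: dvd_power)
  then show "int b dvd e"
    by (simp add: e n dvd_mod)
  have "[int b ^ totient c = 1] (mod int c)"
    using euler_theorem[OF \<open>coprime b c\<close>] by (metis cong_int_iff of_nat_1 of_nat_power)
  then show "[e = 1] (mod int c)"
    by (simp add: e n cong_def mod_mult_left_eq mod_mod_cancel)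
qed

theorem theorem2p5:
  fixes n k b :: nat and p \<alpha> :: "nat \<Rightarrow> nat" and a :: int
  assumes "n > 1"
    and "\<And>i. i \<in> {1..k} \<Longrightarrow> prime (p i)"
    and "inj_on p {1..k}"
    and "\<And>i. i \<in> {1..k} \<Longrightarrow> \<alpha> i > 0"
    and "n = (\<Prod>i\<in>{1..k}. p i ^ \<alpha> i)"
    and "a \<in> GP n - Proj n"
    and "b = (\<Prod>j\<in>{j \<in> {1..k}. \<not> [a = 1] (mod int (p j ^ \<alpha> j))}. p j ^ \<alpha> j)"
  shows "lower_covering_projection n a = (int b mod int n) [^]\<^bsub>Zn n\<^esub> totient (n div b)"
proof -
  define q where "q i = p i ^ \<alpha> i" for i
  define J where "J = {j \<in> {1..k}. \<not> [a = 1] (mod int (q j))}"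
  define c where "c = prod q ({1..k} - J)"
  have J: "J \<subseteq> {1..k}"
    by (auto simp: J_def)
  have b: "b = prod q J"
    using assms(7) by (simp add: q_def J_def)
  have n: "n = b * c"
    using assms(5) prod.subset_diff[OF J, of q] by (simp add: b c_def q_def mult.commute)
  have coprime_q: "coprime (q i) (q j)" if "i \<in> {1..k}" "j \<in> {1..k}" "i \<noteq> j" for i j
  proof -
    have "p i \<noteq> p j"
      using assms(3) that by (meson inj_onD)
    then show ?thesis
      using assms(2) that by (simp add: q_def primes_coprime)
  qed
  have "coprime b c"
    unfolding b c_def by (intro prod_coprime_left prod_coprime_right coprime_q) (use J in auto)
  have "b > 0"
    using assms(1) n by (cases b) auto
  \<comment> \<open>The prime powers outside \<open>J\<close> each divide \<open>a - 1\<close> and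
    are pairwise coprime.\<close>
  have "int c dvd a - 1"
    unfolding c_def of_nat_prod
    by (rule prod_dvd_if_pairwise_coprime)
       (auto simp: J_def cong_iff_dvd_diff intro!: coprime_q)
  then have a_cong: "[a = 1] (mod int c)"
    by (simp add: cong_iff_dvd_diff)
  have below: "int b dvd x" if x: "x \<in> GP n" "[x = x * a] (mod int n)" for x
    unfolding b of_nat_prod
  proof (rule prod_dvd_if_pairwise_coprime)
    fix j assume j: "j \<in> J"
    \<comment> \<open>Both congruences for \<open>x\<close> descend from \<open>n\<close> to the
      component \<open>q j\<close>, where \<open>a\<close> is not 1.\<close>
    have "q j dvd n"
      using assms(5) j J by (auto simp: q_def intro!: dvd_prodI)
    then have q_dvd: "int (p j) ^ \<alpha> j dvd int n"
      by (simp add: q_def flip: of_nat_power)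
    obtain m where m: "m \<ge> 2" "x ^ m mod int n = x"
      using x(1) assms(1) by (auto simp: GP_def residue_ring_pow)
    have "[x ^ m = x] (mod int n)"
      using m(2) by (metis cong_mod_left cong_refl)
    then have "[x ^ m = x] (mod int (p j) ^ \<alpha> j)" "[x = x * a] (mod int (p j) ^ \<alpha> j)"
      using x(2) q_dvd by (blast intro: cong_dvd_modulus)+
    moreover have "\<not> [a = 1] (mod int (p j) ^ \<alpha> j)"
      using j by (simp add: J_def q_def)
    moreover have "prime (int (p j))"
      using assms(2) j J by auto
    ultimately have "int (p j) ^ \<alpha> j dvd x"
      using m(1) by (intro prime_power_dvd_if_mult_fixed)
    then show "int (q j) dvd x"
      by (simp add: q_def)
  next
    fix i j assume "i \<in> J" "j \<in> J" "i \<noteq> j"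
    then show "coprime (int (q i)) (int (q j))"
      using J by (auto intro!: coprime_q)
  qed
  have "n div b = c"
    using n \<open>b > 0\<close> by simp
  then show ?thesis
    using lower_covering_projection_eq_idempotent[OF assms(1) n assms(6) a_cong below]
      idempotent_by_Euler[OF assms(1) n \<open>coprime b c\<close>]
    by simp
qed

end
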